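(* Let $C\ge0$ be a constant and define $$P^{\mathrm{wo\text{-}rep}}_{\mathrm{distr}}:\quad\min\{\mathbf c^T\mathbf x\mid\mathbf A\mathbf x=\mathbf b,\ 0\le x_j\le C/n\ \text{for all }j\in[n]\}.$$ Let $Q=\{q_1,\dots,q_K\}\subset[n]$ be a set of $K$ indices, $1\le K<n$, sampled uniformly at random from $[n]$ without replacement. Let $\gamma$ be an upper bound on $\|\mathbf p\|_\infty$ for every basic solution $\mathbf p$ of the dual problem $D$. For any $\delta\in(0,1)$, with probability at least $1-\delta$, the following implication holds: if $P_Q$ is feasible and $\mathrm{rank}(\mathbf A_Q)=m$, then $$\Delta v(P_Q)\le\Delta v(P^{\mathrm{wo\text{-}rep}}_{\mathrm{distr}})+\frac{C}{\sqrt K}\cdot(1+\gamma\cdot m\cdot\|\mathbf A\|_{\max})\cdot\left(\sqrt{\frac{n-K}{n-1}}+\sqrt{\frac{2}{H_{n,K}}\log\frac2\delta}\right),$$ where $$H_{n,K}=\frac{n-1/2}{n-K}\cdot\left(1-\frac{1}{2\max(K,n-K)}\right).$$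
   Context: The complete problem is $P:\ \min\{\mathbf c^T\mathbf x\mid \mathbf A\mathbf x=\mathbf b,\ \mathbf x\ge \mathbf 0\}$ with $\mathbf A\in\mathbb R^{m\times n}$, $\mathbf b\in\mathbb R^m$, $\mathbf c\in\mathbb R^n$. Standing assumptions: $P$ is feasible and bounded, $\mathrm{rank}(\mathbf A)=m$, $\|\mathbf c\|_2=1$. Its dual is $D:\ \max\{\mathbf p^T\mathbf b\mid \mathbf p^T\mathbf A\le \mathbf c^T\}$. $\|\mathbf A\|_{\max}=\max_{i,j}|A_{i,j}|$, $[n]=\{1,\dots,n\}$. A basis is a set $B\subseteq[n]$ with $|B|=m$ and $\mathbf A_B$ nonsingular; the corresponding basic solution of $D$ (not necessarily feasible) is $\mathbf p^T=\mathbf c_B^T\mathbf A_B^{-1}$. $\mathbf A_Q$ is the submatrix of $\mathbf A$ with columns indexed by $Q$, $\mathbf c_Q$ the corresponding subvector of $\mathbf c$, and $P_Q:\ \min\{\mathbf c_Q^T\tilde{\mathbf x}\mid\mathbf A_Q\tilde{\mathbf x}=\mathbf b,\ \tilde{\mathbf x}\ge\mathbf 0\}$. $v(\cdot)$ denotes the optimal value, with $v=+\infty$ for an infeasible minimization problem, and $\Delta v(P'')=v(P'')-v(P)$. *)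

theory Defs
  imports "HOL-Probability.Probability"
begin

definition max_norm :: "real^'n^'m \<Rightarrow> real" where
  "max_norm A = Max {\<bar>A $ i $ j\<bar> | i j. True}"

(* A selection e :: 'm => 'n of columns. If e is injective, then sel_cols A e is A_B and
   sel c e is c_B for B = range e, with the columns listed in the order given by e. *)
definition sel_cols :: "real^'n^'m \<Rightarrow> ('k \<Rightarrow> 'n) \<Rightarrow> real^'k^'m" where
  "sel_cols A e = (\<chi> i k. A $ i $ e k)"

definition sel :: "real^'n \<Rightarrow> ('k \<Rightarrow> 'n) \<Rightarrow> real^'k" where
  "sel c e = (\<chi> k. c $ e k)"

(* p^T = c_B^T A_B^{-1} for a basis B with |B| = m. The vector p does not depend on the
   enumeration e of B, so quantifying over e is the same as quantifying over B. *)
definition basic_dual_solution :: "real^'n^'m \<Rightarrow> real^'n \<Rightarrow> real^'m \<Rightarrow> bool" where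
  "basic_dual_solution A c p \<longleftrightarrow>
     (\<exists>B (e :: 'm \<Rightarrow> 'n). card B = CARD('m) \<and> bij_betw e UNIV B \<and>
        invertible (sel_cols A e) \<and> p = sel c e v* matrix_inv (sel_cols A e))"

(* Optimal value of a minimization problem; it is \<infinity> for an empty feasible set. *)
definition opt_val :: "('x \<Rightarrow> real) \<Rightarrow> 'x set \<Rightarrow> ereal" where
  "opt_val f F = (INF x\<in>F. ereal (f x))"

definition feas :: "real^'n^'m \<Rightarrow> real^'m \<Rightarrow> (real^'n) set" where
  "feas A b = {x. A *v x = b \<and> (\<forall>j. 0 \<le> x $ j)}"

definition feas_distr :: "real^'n^'m \<Rightarrow> real^'m \<Rightarrow> real \<Rightarrow> (real^'n) set" where
  "feas_distr A b C = {x. A *v x = b \<and> (\<forall>j. 0 \<le> x $ j \<and> x $ j \<le> C / real CARD('n))}"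

(* The index set Q is a set of indices and not a type, so the vectors of R^Q are the
   extensional functions on Q. *)
definition feas_sub :: "real^'n^'m \<Rightarrow> real^'m \<Rightarrow> 'n set \<Rightarrow> ('n \<Rightarrow> real) set" where
  "feas_sub A b Q = {x \<in> Q \<rightarrow>\<^sub>E {0..}. \<forall>i. (\<Sum>j\<in>Q. A $ i $ j * x j) = b $ i}"

definition cost_sub :: "real^'n \<Rightarrow> 'n set \<Rightarrow> ('n \<Rightarrow> real) \<Rightarrow> real" where
  "cost_sub c Q x = (\<Sum>j\<in>Q. c $ j * x j)"

(* rank(A_Q), as the dimension of the space spanned by the columns of A_Q. *)
definition rank_sub :: "real^'n^'m \<Rightarrow> 'n set \<Rightarrow> nat" where
  "rank_sub A Q = dim ((\<lambda>j. column j A) ` Q)"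

lemma rank_sub_UNIV: "rank_sub A UNIV = rank A"
  by (simp add: rank_sub_def column_rank_def columns_def full_SetCompr_eq)

definition gap :: "real^'n^'m \<Rightarrow> real^'m \<Rightarrow> real^'n \<Rightarrow> ereal \<Rightarrow> ereal" where
  "gap A b c v = v - opt_val (\<lambda>x. c \<bullet> x) (feas A b)"

definition H_factor :: "nat \<Rightarrow> nat \<Rightarrow> real" where
  "H_factor n K = (real n - 1/2) / (real n - real K) *
     (1 - 1 / (2 * max (real K) (real n - real K)))"

definition sample_wo_rep :: "nat \<Rightarrow> 'n::finite set pmf" where
  "sample_wo_rep K = pmf_of_set {Q. card Q = K}"

end

(*
  Let x be optimal for the problem with the bounds x_j <= C/n, and scale its restriction to the
  sample Q by n/K. The resulting point need not satisfy the constraints of P_Q, but a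
  near-optimal basic dual solution p of P_Q, which is a basic solution of D with
  norm p <= sqrt m * gamma, turns the violation into an upper bound on the optimal value:
    v(P_Q) <= c^T x + f(Q),
  where f(Q) adds the deviation of the sampled cost and gamma * sqrt m times that of the sampled
  columns. Both deviations are those of a mean of vectors sampled without replacement. The
  variance formula bounds the expectation of f, and f changes by at most
  (2 C / K) (1 + gamma m max_norm A) when one sampled index is exchanged, so the
  bounded-difference inequality for sampling without replacement controls f(Q) - E f.
*)
theory Submission
  imports Defs
begin

section \<open>Averages over samples without replacement\<close>

text \<open>Uniform expectation as a finite sum, so that the sampling arguments become double
  counting. Measures enter only for Hoeffding's lemma and for the final translation in
  \<open>prob_sample_ge\<close>.\<close>

definition avg :: "'a set \<Rightarrow> ('a \<Rightarrow> real) \<Rightarrow> real" where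
  "avg X f = (\<Sum>x\<in>X. f x) / real (card X)"

lemma avg_mono: "(\<And>x. x \<in> X \<Longrightarrow> f x \<le> g x) \<Longrightarrow> avg X f \<le> avg X g"
  unfolding avg_def by (intro divide_right_mono sum_mono) auto

lemma avg_cong: "(\<And>x. x \<in> X \<Longrightarrow> f x = g x) \<Longrightarrow> avg X f = avg X g"
  unfolding avg_def by (simp cong: sum.cong)

lemma avg_add: "avg X (\<lambda>x. f x + g x) = avg X f + avg X g"
  by (simp add: avg_def sum.distrib add_divide_distrib)

lemma avg_mult_left: "avg X (\<lambda>x. a * f x) = a * avg X f"
  by (simp add: avg_def sum_distrib_left)

lemma avg_singleton [simp]: "avg {x} f = f x"
  by (simp add: avg_def)

lemma avg_expectation:
  assumes "finite X" "X \<noteq> {}"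
  shows "measure_pmf.expectation (pmf_of_set X) f = avg X f"
  using assms by (simp add: avg_def integral_pmf_of_set)

lemma avg_le_sqrt_avg_square:
  assumes "finite X" "X \<noteq> {}"
  shows "avg X f \<le> sqrt (avg X (\<lambda>x. (f x)\<^sup>2))"
proof -
  have "(\<Sum>x\<in>X. f x)\<^sup>2 \<le> (\<Sum>x\<in>X. (f x)\<^sup>2) * real (card X)"
    using Cauchy_Schwarz_ineq_sum[of f "\<lambda>_. 1" X] by simp
  then have "(avg X f)\<^sup>2 \<le> avg X (\<lambda>x. (f x)\<^sup>2)"
    using assms by (simp add: avg_def power_divide field_simps power2_eq_square card_gt_0_iff)
  then show ?thesis
    by (rule real_le_rsqrt)
qed

text \<open>The range hypothesis is on pairwise differences because that is what exchanging a drawn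
  element yields. It places \<open>g\<close> in the interval from its minimum to its minimum plus
  \<open>r\<close>, where Hoeffding's lemma for bounded variables applies.\<close>

lemma Hoeffdings_lemma_avg:
  fixes g :: "'a \<Rightarrow> real"
  assumes X: "finite X" "X \<noteq> {}"
    and r: "\<And>x y. x \<in> X \<Longrightarrow> y \<in> X \<Longrightarrow> g x - g y \<le> r"
    and l: "0 < l"
  shows "avg X (\<lambda>x. exp (l * (g x - avg X g))) \<le> exp (l\<^sup>2 * r\<^sup>2 / 8)"
proof -
  define a where "a = Min (g ` X)"
  define M where "M = measure_pmf (pmf_of_set X)"
  define f where "f x = g x - avg X g" for x
  have a: "a \<le> g x" if "x \<in> X" for x
    using X that by (simp add: a_def)
  have "a \<in> g ` X"
    unfolding a_def using X by (intro Min_in) auto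
  then have ar: "g x \<le> a + r" if "x \<in> X" for x
    using r that by fastforce
  have AE: "AE x in M. f x \<in> {a - avg X g .. a + r - avg X g}"
    unfolding M_def f_def AE_measure_pmf_iff using X a ar by auto
  interpret interval_bounded_random_variable M f "a - avg X g" "a + r - avg X g"
    using AE unfolding M_def interval_bounded_random_variable_def interval_bounded_random_variable_axioms_def
    by (simp add: measure_pmf.prob_space_axioms)
  have "(\<integral>x. f x \<partial>M) = 0"
    unfolding M_def using X
    by (simp add: avg_expectation) (simp add: f_def avg_def sum_subtractf diff_divide_distrib)
  from Hoeffdings_lemma_nn_integral_0[OF l this]
  have "nn_integral M (\<lambda>x. exp (l * f x)) \<le> ennreal (exp (l\<^sup>2 * r\<^sup>2 / 8))"
    by simp
  moreover have "nn_integral M (\<lambda>x. exp (l * f x)) = ennreal (avg X (\<lambda>x. exp (l * f x)))"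
    using X
    by (simp add: M_def nn_integral_pmf_of_set avg_def sum_ennreal sum_nonneg
        ennreal_of_nat_eq_real_of_nat divide_ennreal card_gt_0_iff)
  ultimately show ?thesis
    by (simp add: f_def)
qed

section \<open>Subsets of fixed size, drawn one element at a time\<close>

definition ksets :: "'a set \<Rightarrow> nat \<Rightarrow> 'a set set" where
  "ksets S K = {Q. Q \<subseteq> S \<and> card Q = K}"

lemma finite_ksets [simp]: "finite S \<Longrightarrow> finite (ksets S K)"
  by (simp add: ksets_def)

lemma card_ksets: "finite S \<Longrightarrow> card (ksets S K) = card S choose K"
  by (simp add: ksets_def n_subsets)

lemma ksets_nonempty: "finite S \<Longrightarrow> K \<le> card S \<Longrightarrow> ksets S K \<noteq> {}"
  by (metis card_ksets card.empty binomial_eq_0_iff not_less)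

lemma ksets_0: "finite S \<Longrightarrow> ksets S 0 = {{}}"
  by (auto simp: ksets_def dest: finite_subset)

text \<open>Double counting of the pairs (Q, z) with z in Q: each set of size K + 1 arises once for
  each choice of its element z as the first draw.\<close>

lemma sum_ksets_insert:
  fixes h :: "'a set \<Rightarrow> 'b::comm_semiring_1"
  assumes "finite S"
  shows "(\<Sum>z\<in>S. \<Sum>Q\<in>ksets (S - {z}) K. h (insert z Q)) = of_nat (Suc K) * (\<Sum>Q\<in>ksets S (Suc K). h Q)"
proof -
  have fin: "finite Q" if "Q \<in> ksets T k" "T \<subseteq> S" for Q T k
    using that assms by (auto simp: ksets_def intro: finite_subset)
  have "(\<Sum>z\<in>S. \<Sum>Q\<in>ksets (S - {z}) K. h (insert z Q))
      = (\<Sum>(z, Q)\<in>Sigma S (\<lambda>z. ksets (S - {z}) K). h (insert z Q))"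
    by (rule sum.Sigma) (use assms in auto)
  also have "\<dots> = (\<Sum>(Q, z)\<in>Sigma (ksets S (Suc K)) (\<lambda>Q. Q). h Q)"
  proof (rule sum.reindex_bij_witness[where i = "\<lambda>(Q, z). (z, Q - {z})" and j = "\<lambda>(z, Q). (insert z Q, z)"])
    fix p assume "p \<in> Sigma S (\<lambda>z. ksets (S - {z}) K)"
    moreover from this have "finite (snd p)"
      using fin by auto
    ultimately show "(case p of (z, Q) \<Rightarrow> (insert z Q, z)) \<in> Sigma (ksets S (Suc K)) (\<lambda>Q. Q)"
      by (auto simp: ksets_def card_insert_if)
  qed (auto simp: ksets_def insert_absorb)
  also have "\<dots> = (\<Sum>Q\<in>ksets S (Suc K). \<Sum>z\<in>Q. h Q)"
    by (rule sum.Sigma[symmetric]) (use assms fin in auto)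
  also have "\<dots> = (\<Sum>Q\<in>ksets S (Suc K). of_nat (Suc K) * h Q)"
    by (rule sum.cong) (auto simp: ksets_def)
  finally show ?thesis
    by (simp add: sum_distrib_left)
qed

text \<open>The tower rule for sequential sampling: a uniform first element followed by a uniform
  K-set of the rest is a uniform set of size K + 1. The normalisations agree by the absorption
  identity for binomial coefficients.\<close>

lemma avg_ksets_Suc:
  assumes "finite S" "Suc K \<le> card S"
  shows "avg (ksets S (Suc K)) h = avg S (\<lambda>z. avg (ksets (S - {z}) K) (\<lambda>Q. h (insert z Q)))"
proof -
  obtain N where N: "card S = Suc N"
    using assms by (cases "card S") auto
  have "avg S (\<lambda>z. avg (ksets (S - {z}) K) (\<lambda>Q. h (insert z Q)))
      = (\<Sum>z\<in>S. \<Sum>Q\<in>ksets (S - {z}) K. h (insert z Q)) / (real (Suc N) * real (N choose K))"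
    unfolding avg_def using assms N
    by (simp add: card_ksets sum_divide_distrib[symmetric] mult.commute)
  also have "real (Suc N) * real (N choose K) = real (Suc N choose Suc K) * real (Suc K)"
    using Suc_times_binomial_eq[of N K] by (metis of_nat_mult)
  finally show ?thesis
    unfolding sum_ksets_insert[OF assms(1)] avg_def
    using assms N by (simp add: card_ksets del: of_nat_Suc binomial_Suc_Suc)
qed

text \<open>The factor is the fraction of the K-subsets of \<open>S - {z}\<close> that omit
  \<open>z'\<close>. Only these contribute to the difference, each by at most \<beta>.\<close>

lemma avg_ksets_swap:
  fixes h :: "'a set \<Rightarrow> real"
  assumes S: "finite S" and z: "z \<in> S" "z' \<in> S" and K: "Suc K < card S"
    and h: "\<And>R. R \<subseteq> S - {z, z'} \<Longrightarrow> card R = K \<Longrightarrow> \<bar>h (insert z R) - h (insert z' R)\<bar> \<le> \<beta>"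
  shows "\<bar>avg (ksets (S - {z}) K) (\<lambda>Q. h (insert z Q)) - avg (ksets (S - {z'}) K) (\<lambda>Q. h (insert z' Q))\<bar>
     \<le> \<beta> * (real (card S) - real (Suc K)) / (real (card S) - 1)"
proof (cases "z = z'")
  case True
  \<comment> \<open>For equal elements the claim reduces to nonnegativity of \<beta>, which follows
    from the hypothesis at any single admissible \<open>R\<close>.\<close>
  have "K \<le> card (S - {z})"
    using S z K by simp
  then obtain R where "R \<subseteq> S - {z}" "card R = K"
    by (rule obtain_subset_with_card_n)
  then have "0 \<le> \<beta>"
    using h[of R] True by auto
  then show ?thesis
    using True K by (auto intro!: divide_nonneg_nonneg mult_nonneg_nonneg)
next
  case False
  define T where "T = S - {z, z'}"
  define N where "N = card S - 2"
  have T: "finite T" "card T = N" "card S = Suc (Suc N)" "S = insert z (insert z' T)" "z \<notin> T" "z' \<notin> T"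
    using S z K False by (auto simp: T_def N_def card_Diff_insert)
  \<comment> \<open>Samples that contain both \<open>z\<close> and \<open>z'\<close> contribute equally to the two sums and cancel.\<close>
  have split: "(\<Sum>Q\<in>ksets (insert y T) K. F Q)
      = (\<Sum>Q\<in>ksets T K. F Q) + (\<Sum>Q\<in>{R. R \<subseteq> T \<and> Suc (card R) = K}. F (insert y Q))"
    if "y \<notin> T" for y and F :: "'a set \<Rightarrow> real"
  proof -
    have "ksets (insert y T) K = ksets T K \<union> insert y ` {R. R \<subseteq> T \<and> Suc (card R) = K}" (is "?l = ?r")
    proof
      show "?r \<subseteq> ?l"
        using that finite_subset[OF _ T(1)] by (auto simp: ksets_def card_insert_if)
      show "?l \<subseteq> ?r"
      proof
        fix Q assume Q: "Q \<in> ?l"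
        show "Q \<in> ?r"
        proof (cases "y \<in> Q")
          case True
          have Q': "Q \<subseteq> insert y T" "card Q = K"
            using Q unfolding ksets_def by auto
          have "finite Q"
            by (rule finite_subset[OF Q'(1)]) (simp add: T(1))
          from card.remove[OF this True] have "Suc (card (Q - {y})) = K"
            unfolding Q'(2) by (rule sym)
          moreover have "Q - {y} \<subseteq> T"
            using Q'(1) by blast
          moreover have "insert y (Q - {y}) = Q"
            using True by (rule insert_Diff)
          ultimately show ?thesis
            by (intro UnI2 image_eqI[of _ _ "Q - {y}"]) simp_all
        qed (use Q in \<open>auto simp: ksets_def\<close>)
      qed
    qed
    moreover have "ksets T K \<inter> insert y ` {R. R \<subseteq> T \<and> Suc (card R) = K} = {}"
      using that by (auto simp: ksets_def)
    moreover have "inj_on (insert y) {R. R \<subseteq> T \<and> Suc (card R) = K}"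
      using that by (intro inj_onI) (metis insert_ident mem_Collect_eq subsetD)
    ultimately show ?thesis
      using T(1) by (simp add: sum.union_disjoint sum.reindex)
  qed
  have Sz: "S - {z} = insert z' T" "S - {z'} = insert z T"
    using T False by auto
  have "avg (ksets (S - {z}) K) (\<lambda>Q. h (insert z Q)) - avg (ksets (S - {z'}) K) (\<lambda>Q. h (insert z' Q))
      = (\<Sum>R\<in>ksets T K. h (insert z R) - h (insert z' R)) / real (Suc N choose K)"
    unfolding avg_def Sz
    by (simp add: split T card_ksets insert_commute[of z z'] sum_subtractf diff_divide_distrib
        add_divide_distrib)
  also have "\<bar>\<dots>\<bar> \<le> (\<Sum>R\<in>ksets T K. \<beta>) / real (Suc N choose K)"
    unfolding abs_divide abs_of_nat
    by (intro divide_right_mono order_trans[OF sum_abs] sum_mono h)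
      (auto simp: ksets_def T_def[symmetric])
  also have "\<dots> = \<beta> * real (N choose K) / real (Suc N choose K)"
    using T by (simp add: card_ksets)
  also have "real (N choose K) / real (Suc N choose K) = (real (card S) - real (Suc K)) / (real (card S) - 1)"
  proof -
    have "real (Suc N - K) * real (Suc N choose K) = real (Suc N) * real (N choose K)"
      using binomial_absorb_comp[of "Suc N" K] by (metis diff_Suc_1 of_nat_mult)
    then show ?thesis
      using K T(3) by (simp add: divide_simps of_nat_diff) (simp add: algebra_simps)
  qed
  then have "\<beta> * real (N choose K) / real (Suc N choose K) = \<beta> * (real (card S) - real (Suc K)) / (real (card S) - 1)"
    by (metis times_divide_eq_right)
  finally show ?thesis .
qed

section \<open>Bounded differences\<close>

text \<open>\<open>R\<close> is the common part of two samples that differ in one element. Writing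
  its size as \<open>Suc (card R) = K\<close> makes the condition vacuous for K = 0, where the
  induction starts.\<close>

definition swap_bounded :: "'a set \<Rightarrow> nat \<Rightarrow> ('a set \<Rightarrow> real) \<Rightarrow> real \<Rightarrow> bool" where
  "swap_bounded S K f \<beta> \<longleftrightarrow> (\<forall>R z z'. R \<subseteq> S \<longrightarrow> Suc (card R) = K \<longrightarrow> z \<in> S - R \<longrightarrow> z' \<in> S - R \<longrightarrow>
     \<bar>f (insert z R) - f (insert z' R)\<bar> \<le> \<beta>)"

text \<open>The elements of the sample are drawn one at a time. After the first \<open>i - 1\<close> draws, the conditional
  mean of \<open>f\<close> given the \<open>i\<close>-th one varies by at most \<open>\<beta> (N - K) / (N - i)\<close>, because by a coupling
  only the samples that omit the competing element contribute.\<close>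

lemma mgf_ksets:
  assumes "finite S" "K < card S" "swap_bounded S K f \<beta>" "0 < l"
  shows "avg (ksets S K) (\<lambda>Q. exp (l * (f Q - avg (ksets S K) f)))
    \<le> exp (l\<^sup>2 / 8 * (\<Sum>i=1..K. (\<beta> * (real (card S) - real K) / (real (card S) - real i))\<^sup>2))"
  using assms
proof (induction K arbitrary: S f)
  case 0
  then show ?case by (simp add: ksets_0)
next
  case (Suc K)
  define N where "N = card S"
  \<comment> \<open>\<open>r\<^sup>2\<close> is the term i = 1 of the claimed sum. \<open>V\<close>
    is the sum for a population of N - 1 and a sample of K, and becomes the remaining terms after
    the shift from i to i + 1.\<close>
  define V where "V = (\<Sum>i=1..K. (\<beta> * (real (N - 1) - real K) / (real (N - 1) - real i))\<^sup>2)"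
  define r where "r = \<beta> * (real N - real (Suc K)) / (real N - 1)"
  define g where "g z = avg (ksets (S - {z}) K) (\<lambda>Q. f (insert z Q))" for z
  define \<mu> where "\<mu> = avg S g"
  have S: "finite S" "Suc K < N" "S \<noteq> {}"
    using Suc.prems by (auto simp: N_def)
  have \<mu>: "avg (ksets S (Suc K)) f = \<mu>"
    using S by (simp add: avg_ksets_Suc N_def g_def[abs_def] \<mu>_def)
  have IH: "avg (ksets (S - {z}) K) (\<lambda>Q. exp (l * (f (insert z Q) - g z))) \<le> exp (l\<^sup>2 / 8 * V)"
    if z: "z \<in> S" for z
  proof -
    have card: "card (S - {z}) = N - 1"
      using z S by (simp add: N_def)
    have "swap_bounded (S - {z}) K (\<lambda>Q. f (insert z Q)) \<beta>"
      unfolding swap_bounded_def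
    proof (intro allI impI)
      fix R y y'
      assume *: "R \<subseteq> S - {z}" "Suc (card R) = K" "y \<in> S - {z} - R" "y' \<in> S - {z} - R"
      then have "\<bar>f (insert y (insert z R)) - f (insert y' (insert z R))\<bar> \<le> \<beta>"
        using z finite_subset[OF subset_trans[OF *(1) Diff_subset] S(1)]
        by (intro Suc.prems(3)[unfolded swap_bounded_def, rule_format]) (auto simp: card_insert_if)
      then show "\<bar>f (insert z (insert y R)) - f (insert z (insert y' R))\<bar> \<le> \<beta>"
        by (simp add: insert_commute)
    qed
    from Suc.IH[OF _ _ this Suc.prems(4)] show ?thesis
      using S by (simp add: card g_def V_def)
  qed
  have range: "g x - g y \<le> r" if "x \<in> S" "y \<in> S" for x y
  proof -
    have "\<bar>g x - g y\<bar> \<le> r"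
      unfolding g_def r_def N_def
    proof (rule avg_ksets_swap)
      fix R assume "R \<subseteq> S - {x, y}" "card R = K"
      then show "\<bar>f (insert x R) - f (insert y R)\<bar> \<le> \<beta>"
        using that by (intro Suc.prems(3)[unfolded swap_bounded_def, rule_format]) auto
    qed (use S that N_def in auto)
    then show ?thesis by simp
  qed
  \<comment> \<open>Condition on the first element z and split the deviation into that of the
    conditional mean \<open>g z\<close> from \<mu>, handled by Hoeffding's lemma, and that of
    \<open>f\<close> from \<open>g z\<close>, handled by induction.\<close>
  have "avg (ksets S (Suc K)) (\<lambda>Q. exp (l * (f Q - \<mu>)))
      = avg S (\<lambda>z. exp (l * (g z - \<mu>)) * avg (ksets (S - {z}) K) (\<lambda>Q. exp (l * (f (insert z Q) - g z))))"
    using S by (simp add: avg_ksets_Suc N_def avg_mult_left[symmetric] exp_add[symmetric] algebra_simps)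
  also have "\<dots> \<le> avg S (\<lambda>z. exp (l\<^sup>2 / 8 * V) * exp (l * (g z - \<mu>)))"
    by (rule avg_mono) (subst mult.commute, intro mult_right_mono IH, auto)
  also have "\<dots> \<le> exp (l\<^sup>2 / 8 * V) * exp (l\<^sup>2 * r\<^sup>2 / 8)"
    unfolding avg_mult_left \<mu>_def
    by (intro mult_left_mono Hoeffdings_lemma_avg) (use S range Suc.prems in auto)
  also have "\<dots> = exp (l\<^sup>2 / 8 * (r\<^sup>2 + V))"
    by (simp add: exp_add[symmetric] algebra_simps)
  also have "r\<^sup>2 + V = (\<Sum>i=1..Suc K. (\<beta> * (real N - real (Suc K)) / (real N - real i))\<^sup>2)"
  proof -
    have "V = (\<Sum>i=1..K. (\<beta> * (real N - real (Suc K)) / (real N - real (Suc i)))\<^sup>2)"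
      unfolding V_def using S by (intro sum.cong refl) (simp add: of_nat_diff algebra_simps)
    also have "\<dots> = (\<Sum>i=Suc 1..Suc K. (\<beta> * (real N - real (Suc K)) / (real N - real i))\<^sup>2)"
      by (simp only: sum.shift_bounds_cl_Suc_ivl)
    finally show ?thesis
      by (subst sum.atLeast_Suc_atMost) (auto simp: r_def)
  qed
  finally show ?case
    by (simp only: \<mu> N_def)
qed

text \<open>Telescoping: 1/x^2 is at most 1/(x^2 - 1/4) = 1/(x - 1/2) - 1/(x + 1/2). This is the
  origin of the halves in \<open>H_factor\<close>.\<close>

lemma sum_inverse_squares_le:
  fixes N :: real
  assumes "real K + 1 \<le> N"
  shows "(\<Sum>i=1..K. 1 / (N - real i)\<^sup>2) \<le> 1 / (N - real K - 1/2) - 1 / (N - 1/2)"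
  using assms
proof (induction K)
  case (Suc K)
  define x where "x = N - real (Suc K)"
  have x: "x \<ge> 1"
    using Suc.prems by (simp add: x_def)
  have "1 / x\<^sup>2 \<le> 1 / (x\<^sup>2 - 1/4)"
    using one_le_power[OF x, of 2] by (intro divide_left_mono mult_pos_pos) linarith+
  also have "\<dots> = 1 / (x - 1/2) - 1 / (x + 1/2)"
    using x one_le_power[OF x, of 2]
    by (simp add: divide_simps power2_eq_square) (auto simp: algebra_simps)
  finally have "1 / (N - real (Suc K))\<^sup>2 \<le> 1 / (N - real (Suc K) - 1/2) - 1 / (N - real K - 1/2)"
    by (simp add: x_def algebra_simps)
  then show ?case
    using Suc by simp
qed simp

text \<open>The Chernoff method: Markov's inequality for the exponential moment bounded in
  \<open>mgf_ksets\<close>, with the sum of squares there replaced by its telescoped bound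
  \<open>s\<close>.\<close>

lemma tail_ksets:
  fixes f :: "'a set \<Rightarrow> real"
  assumes S: "finite S" and K: "1 \<le> K" "K < card S" and f: "swap_bounded S K f \<beta>"
    and pos: "0 < \<beta>" "0 < \<epsilon>"
  defines "N \<equiv> real (card S)"
  shows "avg (ksets S K) (\<lambda>Q. of_bool (f Q \<ge> avg (ksets S K) f + \<epsilon>))
    \<le> exp (- 2 * \<epsilon>\<^sup>2 * (N - 1/2) * (1 - 1 / (2 * (N - real K))) / (\<beta>\<^sup>2 * real K * (N - real K)))"
proof -
  define s where "s = \<beta>\<^sup>2 * (N - real K)\<^sup>2 * (real K / ((N - real K - 1/2) * (N - 1/2)))"
  \<comment> \<open>This value minimises the exponent - l \<epsilon> + l^2 s / 8 and makes it equal
    to - 2 \<epsilon>^2 / s.\<close>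
  define l where "l = 4 * \<epsilon> / s"
  define \<mu> where "\<mu> = avg (ksets S K) f"
  have N: "N \<ge> real K + 1" "N > 0"
    using K by (auto simp: N_def)
  have s: "s > 0"
    unfolding s_def using N K pos by (intro mult_pos_pos divide_pos_pos zero_less_power) auto
  have l: "l > 0"
    using s pos by (simp add: l_def)
  have "(\<Sum>i=1..K. (\<beta> * (N - real K) / (N - real i))\<^sup>2) = \<beta>\<^sup>2 * (N - real K)\<^sup>2 * (\<Sum>i=1..K. 1 / (N - real i)\<^sup>2)"
    by (simp add: sum_distrib_left power_divide power_mult_distrib)
  also have "\<dots> \<le> \<beta>\<^sup>2 * (N - real K)\<^sup>2 * (1 / (N - real K - 1/2) - 1 / (N - 1/2))"
    by (intro mult_left_mono sum_inverse_squares_le N) auto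
  also have "1 / (N - real K - 1/2) - 1 / (N - 1/2) = real K / ((N - real K - 1/2) * (N - 1/2))"
    using N K by (simp add: divide_simps)
  finally have V: "(\<Sum>i=1..K. (\<beta> * (N - real K) / (N - real i))\<^sup>2) \<le> s"
    by (simp add: s_def)
  have "avg (ksets S K) (\<lambda>Q. of_bool (f Q \<ge> \<mu> + \<epsilon>))
      \<le> avg (ksets S K) (\<lambda>Q. exp (- l * \<epsilon>) * exp (l * (f Q - \<mu>)))"
  proof (rule avg_mono)
    fix Q
    have "0 \<le> l * (f Q - \<mu> - \<epsilon>)" if "f Q \<ge> \<mu> + \<epsilon>"
      using l that by simp
    then show "of_bool (f Q \<ge> \<mu> + \<epsilon>) \<le> exp (- l * \<epsilon>) * exp (l * (f Q - \<mu>))"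
      by (auto simp: exp_add[symmetric] algebra_simps)
  qed
  also have "\<dots> \<le> exp (- l * \<epsilon>) * exp (l\<^sup>2 / 8 * s)"
    unfolding avg_mult_left \<mu>_def
    using mgf_ksets[OF S K(2) f l] V unfolding N_def
    by (intro mult_left_mono) (auto elim!: order_trans intro!: mult_left_mono)
  also have "\<dots> = exp (- 2 * \<epsilon>\<^sup>2 / s)"
    using s by (simp add: exp_add[symmetric] l_def power2_eq_square field_simps)
  also have "- 2 * \<epsilon>\<^sup>2 / s = - 2 * \<epsilon>\<^sup>2 * (N - 1/2) * (1 - 1 / (2 * (N - real K))) / (\<beta>\<^sup>2 * real K * (N - real K))"
    unfolding s_def using N K pos by (simp add: divide_simps power2_eq_square)
  finally show ?thesis
    by (simp add: \<mu>_def)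
qed

lemma bij_betw_ksets_complement:
  assumes "finite S" "K \<le> card S"
  shows "bij_betw (\<lambda>R. S - R) (ksets S (card S - K)) (ksets S K)"
  by (rule bij_betw_byWitness[where f' = "\<lambda>R. S - R"])
    (use assms in \<open>auto simp: ksets_def card_Diff_subset finite_subset\<close>)

lemma avg_ksets_complement:
  assumes "finite S" "K \<le> card S"
  shows "avg (ksets S (card S - K)) (\<lambda>R. h (S - R)) = avg (ksets S K) h"
  unfolding avg_def
  using sum.reindex_bij_betw[OF bij_betw_ksets_complement[OF assms], of h]
    bij_betw_same_card[OF bij_betw_ksets_complement[OF assms]] by simp

text \<open>The one-sided bound \<open>tail_ksets\<close> is not symmetric in \<open>K\<close> and \<open>N - K\<close>; the maximum in \<open>H_factor\<close>
  comes from applying it to whichever of the sample and its complement is smaller.\<close>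

lemma concentration_ksets:
  fixes f :: "'a set \<Rightarrow> real"
  assumes S: "finite S" and K: "1 \<le> K" "K < card S" and f: "swap_bounded S K f \<beta>"
    and pos: "0 < \<beta>" "0 < \<epsilon>"
  shows "avg (ksets S K) (\<lambda>Q. of_bool (f Q \<ge> avg (ksets S K) f + \<epsilon>))
    \<le> exp (- 2 * \<epsilon>\<^sup>2 * H_factor (card S) K / (\<beta>\<^sup>2 * real K))"
proof (cases "real K \<le> real (card S) - real K")
  case True
  then show ?thesis
    using tail_ksets[OF assms] by (simp add: H_factor_def max_def mult_ac)
next
  case False
  define L where "L = card S - K"
  have L: "1 \<le> L" "L < card S" "real L = real (card S) - real K"
    using K by (auto simp: L_def)
  \<comment> \<open>Exchanging one element of \<open>R\<close> exchanges one element of its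
    complement in the opposite direction, so the same \<beta> serves.\<close>
  have "swap_bounded S L (\<lambda>R. f (S - R)) \<beta>"
    unfolding swap_bounded_def
  proof (intro allI impI)
    fix R z z'
    assume R: "R \<subseteq> S" "Suc (card R) = L" "z \<in> S - R" "z' \<in> S - R"
    show "\<bar>f (S - insert z R) - f (S - insert z' R)\<bar> \<le> \<beta>"
    proof (cases "z = z'")
      case True
      then show ?thesis using pos by simp
    next
      case False
      define T where "T = S - insert z (insert z' R)"
      have eqs: "S - insert z R = insert z' T" "S - insert z' R = insert z T"
        using R False by (auto simp: T_def)
      have "card (S - insert z R) = K"
        using R S L K by (subst card_Diff_subset) (auto simp: card_insert_if finite_subset L_def)
      moreover have "finite T" "z' \<notin> T"
        using S by (auto simp: T_def)
      ultimately have T: "Suc (card T) = K"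
        by (simp add: eqs)
      have "\<bar>f (insert z' T) - f (insert z T)\<bar> \<le> \<beta>"
        by (rule f[unfolded swap_bounded_def, rule_format]) (use R T in \<open>auto simp: T_def\<close>)
      then show ?thesis
        by (simp only: eqs)
    qed
  qed
  note tail = tail_ksets[OF S L(1,2) this pos]
  have "avg (ksets S L) (\<lambda>R. f (S - R)) = avg (ksets S K) f"
    using avg_ksets_complement[of S K f] S K by (simp add: L_def)
  \<comment> \<open>The product K (N - K) in the exponent is unchanged when K is replaced by N - K,
    while the correction becomes 1 - 1/(2K), which is the one selected by the maximum in this
    case.\<close>
  with tail have "avg (ksets S L) (\<lambda>R. of_bool (f (S - R) \<ge> avg (ksets S K) f + \<epsilon>))
      \<le> exp (- 2 * \<epsilon>\<^sup>2 * H_factor (card S) K / (\<beta>\<^sup>2 * real K))"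
    using False by (simp add: H_factor_def max_def L(3) mult_ac)
  then show ?thesis
    using avg_ksets_complement[of S K "\<lambda>Q. of_bool (f Q \<ge> avg (ksets S K) f + \<epsilon>)"] S K
    by (simp add: L_def)
qed

section \<open>Bounded differences of sample means, and the passage to the sampling
  distribution\<close>

lemma swap_bounded_norm_mean:
  fixes v :: "'a \<Rightarrow> 'b::real_normed_vector"
  assumes S: "finite S" and v: "\<And>j. j \<in> S \<Longrightarrow> norm (v j) \<le> M"
  shows "swap_bounded S K (\<lambda>Q. norm ((1 / real K) *\<^sub>R (\<Sum>j\<in>Q. v j) - \<mu>)) (2 * M / real K)"
  unfolding swap_bounded_def
proof (intro allI impI)
  fix R z z'
  assume R: "R \<subseteq> S" "Suc (card R) = K" "z \<in> S - R" "z' \<in> S - R"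
  have fin: "finite R"
    using R(1) S by (rule finite_subset)
  \<comment> \<open>The centre \<mu> cancels in the reverse triangle inequality, so only the
    exchanged summand divided by K remains.\<close>
  have "\<bar>norm ((1 / real K) *\<^sub>R (\<Sum>j\<in>insert z R. v j) - \<mu>) - norm ((1 / real K) *\<^sub>R (\<Sum>j\<in>insert z' R. v j) - \<mu>)\<bar>
      \<le> norm ((1 / real K) *\<^sub>R (\<Sum>j\<in>insert z R. v j) - \<mu> - ((1 / real K) *\<^sub>R (\<Sum>j\<in>insert z' R. v j) - \<mu>))"
    by (rule norm_triangle_ineq3)
  also have "\<dots> = norm ((1 / real K) *\<^sub>R (v z - v z'))"
    using R fin by (simp add: scaleR_add_right scaleR_diff_right)
  also have "\<dots> = norm (v z - v z') / real K"
    by simp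
  also have "\<dots> \<le> (M + M) / real K"
    using R by (intro divide_right_mono norm_triangle_le_diff add_mono v) auto
  finally show "\<bar>norm ((1 / real K) *\<^sub>R (\<Sum>j\<in>insert z R. v j) - \<mu>) - norm ((1 / real K) *\<^sub>R (\<Sum>j\<in>insert z' R. v j) - \<mu>)\<bar>
      \<le> 2 * M / real K"
    by simp
qed

lemma swap_bounded_add:
  assumes "swap_bounded S K f \<alpha>" "swap_bounded S K g \<beta>"
  shows "swap_bounded S K (\<lambda>Q. f Q + g Q) (\<alpha> + \<beta>)"
  using assms unfolding swap_bounded_def
  by (smt (verit))

lemma swap_bounded_mult:
  assumes "swap_bounded S K f \<beta>" "0 \<le> r"
  shows "swap_bounded S K (\<lambda>Q. r * f Q) (r * \<beta>)"
  using assms unfolding swap_bounded_def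
  by (auto simp: right_diff_distrib[symmetric] abs_mult intro!: mult_left_mono)

text \<open>Every sample outside \<open>G\<close> satisfies \<open>P\<close>, so an averaged bound
  on \<open>P\<close> controls the failure probability.\<close>

lemma prob_sample_ge:
  assumes "K \<le> CARD('n::finite)"
    and P: "\<And>Q :: 'n set. Q \<in> ksets UNIV K \<Longrightarrow> Q \<notin> G \<Longrightarrow> P Q"
  shows "1 - avg (ksets UNIV K) (\<lambda>Q. of_bool (P Q)) \<le> measure_pmf.prob (sample_wo_rep K) G"
proof -
  have "{Q :: 'n set. card Q = K} = ksets UNIV K"
    by (simp add: ksets_def)
  then have eq: "sample_wo_rep K = pmf_of_set (ksets (UNIV :: 'n set) K)"
    by (simp add: sample_wo_rep_def)
  have ne: "ksets (UNIV :: 'n set) K \<noteq> {}"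
    using assms(1) by (intro ksets_nonempty) auto
  have "measure_pmf.prob (sample_wo_rep K) (- G) = avg (ksets UNIV K) (indicat_real (- G))"
    using ne by (simp add: eq flip: avg_expectation)
  also have "\<dots> \<le> avg (ksets UNIV K) (\<lambda>Q. of_bool (P Q))"
    using P by (intro avg_mono) (auto simp: indicator_def)
  finally show ?thesis
    using measure_pmf.prob_compl[of "- G" "sample_wo_rep K"] by (simp add: Compl_eq_Diff_UNIV[symmetric])
qed

lemma H_factor_pos:
  assumes "1 \<le> K" "K < n"
  shows "0 < H_factor n K"
  unfolding H_factor_def using assms
  by (intro mult_pos_pos divide_pos_pos) (auto simp: field_simps max_def)

section \<open>The variance of sample means\<close>

text \<open>A K-set containing \<open>T\<close> is determined by its remainder outside
  \<open>T\<close>. Applied to one or two elements, the count gives inclusion probabilities.\<close>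

lemma card_ksets_superset:
  assumes "finite S" "T \<subseteq> S" "card T \<le> K"
  shows "card {Q \<in> ksets S K. T \<subseteq> Q} = (card S - card T) choose (K - card T)"
proof -
  have fT: "finite T"
    using assms finite_subset by blast
  have "bij_betw (\<lambda>R. R \<union> T) (ksets (S - T) (K - card T)) {Q \<in> ksets S K. T \<subseteq> Q}"
  proof (rule bij_betw_byWitness[where f' = "\<lambda>Q. Q - T"])
    show "(\<lambda>R. R \<union> T) ` ksets (S - T) (K - card T) \<subseteq> {Q \<in> ksets S K. T \<subseteq> Q}"
    proof clarsimp
      fix R assume R: "R \<in> ksets (S - T) (K - card T)"
      then have "card (R \<union> T) = card R + card T"
        using assms fT by (intro card_Un_disjoint) (auto simp: ksets_def intro: finite_subset)
      then show "R \<union> T \<in> ksets S K"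
        using R assms by (auto simp: ksets_def)
    qed
  qed (use assms fT in \<open>auto simp: ksets_def card_Diff_subset\<close>)
  then show ?thesis
    using assms fT by (simp add: bij_betw_same_card[symmetric] card_ksets card_Diff_subset)
qed

text \<open>The variance of a sample sum in a centred finite population. Expanding the square
  weights each inner product by a pair inclusion probability, \<open>p1\<close> on the diagonal and
  \<open>p2\<close> off it. The part with constant weight \<open>p2\<close> is the squared norm of
  the total, hence zero, and the diagonal keeps the weight \<open>p1 - p2\<close>.\<close>

lemma avg_ksets_norm_sum:
  fixes u :: "'a \<Rightarrow> 'b::real_inner"
  assumes S: "finite S" and K: "1 \<le> K" "K < card S" and u: "(\<Sum>j\<in>S. u j) = 0"
  defines "N \<equiv> real (card S)"
  shows "avg (ksets S K) (\<lambda>Q. (norm (\<Sum>j\<in>Q. u j))\<^sup>2)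
    = real K * (N - real K) / (N * (N - 1)) * (\<Sum>j\<in>S. (norm (u j))\<^sup>2)"
proof -
  define n k where "n = card S - 2" and "k = K - 1"
  have nk: "card S = Suc (Suc n)" "K = Suc k" "k \<le> n"
    using K by (auto simp: n_def k_def)
  define p where "p i j = avg (ksets S K) (\<lambda>Q. of_bool ({i, j} \<subseteq> Q))" for i j :: 'a
  define p1 p2 where "p1 = real K / N" and "p2 = real K * (real K - 1) / (N * (N - 1))"
  have p: "p i j = p2 + (p1 - p2) * of_bool (i = j)" if ij: "i \<in> S" "j \<in> S" for i j
  proof -
    have eq: "p i j = real (card {Q \<in> ksets S K. {i, j} \<subseteq> Q}) / real (card S choose K)"
      using S by (simp add: p_def avg_def card_ksets sum.If_cases of_bool_def Int_def)
    have c1: "real (Suc k) * real (Suc (Suc n) choose Suc k) = real (Suc (Suc n)) * real (Suc n choose k)"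
      using Suc_times_binomial_eq[of "Suc n" k] by (metis mult.commute of_nat_mult)
    show ?thesis
    proof (cases "i = j")
      case True
      have "card {Q \<in> ksets S K. {i, j} \<subseteq> Q} = Suc n choose k"
        using card_ksets_superset[OF S, of "{i, j}" K] True ij nk by simp
      then show ?thesis
        using c1 nk True unfolding eq p1_def N_def
        by (simp add: divide_simps del: binomial_Suc_Suc of_nat_Suc) 
    next
      case False
      show ?thesis
      proof (cases k)
        \<comment> \<open>A sample of one element contains no pair, in accordance with
          \<open>p2 = 0\<close>. The superset count requires at least two draws and does not cover
          this case.\<close>
        case 0
        then have "{Q \<in> ksets S K. {i, j} \<subseteq> Q} = {}"
          using nk False by (auto simp: ksets_def card_1_singleton_iff)
        then show ?thesis
          using False nk 0 by (simp only: eq p2_def) simp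
      next
        case (Suc k')
        have "card {Q \<in> ksets S K. {i, j} \<subseteq> Q} = n choose k'"
          using card_ksets_superset[OF S, of "{i, j}" K] False ij nk Suc by simp
        moreover have "real k * real (Suc n choose k) = real (Suc n) * real (n choose k')"
          using Suc_times_binomial_eq[of n k'] Suc by (metis mult.commute of_nat_mult)
        then have "real (Suc k) * real k * (Suc (Suc n) choose Suc k)
            = real (Suc (Suc n)) * real (Suc n) * (n choose k')"
          using c1 by (metis mult.assoc mult.left_commute)
        ultimately show ?thesis
          using nk False unfolding eq p2_def N_def
          by (simp add: divide_simps del: binomial_Suc_Suc)
      qed
    qed
  qed
  have "avg (ksets S K) (\<lambda>Q. (norm (\<Sum>j\<in>Q. u j))\<^sup>2)
      = avg (ksets S K) (\<lambda>Q. \<Sum>i\<in>S. \<Sum>j\<in>S. of_bool ({i, j} \<subseteq> Q) * (u i \<bullet> u j))"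
  proof (rule avg_cong)
    fix Q assume "Q \<in> ksets S K"
    then have Q: "Q \<subseteq> S" by (simp add: ksets_def)
    have "(\<Sum>j\<in>Q. u j) = (\<Sum>j\<in>S. of_bool (j \<in> Q) *\<^sub>R u j)"
      using S Q by (intro sum.mono_neutral_cong_left) auto
    then show "(norm (\<Sum>j\<in>Q. u j))\<^sup>2 = (\<Sum>i\<in>S. \<Sum>j\<in>S. of_bool ({i, j} \<subseteq> Q) * (u i \<bullet> u j))"
      by (simp only: power2_norm_eq_inner inner_sum_left)
        (simp add: inner_sum_right of_bool_conj mult_ac sum_distrib_left)
  qed
  also have "\<dots> = (\<Sum>i\<in>S. \<Sum>j\<in>S. p i j * (u i \<bullet> u j))"
    unfolding p_def avg_def
    by (simp add: sum_distrib_right sum_divide_distrib del: insert_subset)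
      (simp add: sum.swap[where B = "ksets S K"] del: insert_subset)
  also have "\<dots> = (\<Sum>i\<in>S. \<Sum>j\<in>S. p2 * (u i \<bullet> u j) + (p1 - p2) * (if i = j then u i \<bullet> u i else 0))"
    by (intro sum.cong refl) (auto simp: p algebra_simps)
  also have "\<dots> = p2 * ((\<Sum>i\<in>S. u i) \<bullet> (\<Sum>j\<in>S. u j)) + (p1 - p2) * (\<Sum>i\<in>S. u i \<bullet> u i)"
    using S by (simp add: sum.distrib inner_sum_left inner_sum_right sum_distrib_left[symmetric])
      (subst sum.swap, simp)
  also have "\<dots> = (p1 - p2) * (\<Sum>i\<in>S. (norm (u i))\<^sup>2)"
    by (simp add: u power2_norm_eq_inner)
  also have "p1 - p2 = real K * (N - real K) / (N * (N - 1))"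
    using nk unfolding p1_def p2_def N_def by (simp add: divide_simps) (simp add: algebra_simps)
  finally show ?thesis .
qed

text \<open>The mean of the norm is at most the root of the mean square, which the variance formula
  evaluates after centring. Centring at the population mean does not increase the sum of squares, so
  that sum stays below N M^2.\<close>

lemma avg_ksets_norm_sum_le:
  fixes v :: "'a \<Rightarrow> 'b::real_inner"
  assumes S: "finite S" and K: "1 \<le> K" "K < card S"
    and v: "\<And>j. j \<in> S \<Longrightarrow> norm (v j) \<le> M"
  defines "N \<equiv> real (card S)"
  shows "avg (ksets S K) (\<lambda>Q. norm ((1 / real K) *\<^sub>R (\<Sum>j\<in>Q. v j) - (1 / N) *\<^sub>R (\<Sum>j\<in>S. v j)))
    \<le> M / sqrt (real K) * sqrt ((N - real K) / (N - 1))"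
proof -
  define \<mu> where "\<mu> = (1 / N) *\<^sub>R (\<Sum>j\<in>S. v j)"
  define u where "u j = v j - \<mu>" for j
  have N: "N > 1" "real K < N"
    using K by (auto simp: N_def)
  have ne: "S \<noteq> {}" using K by auto
  then obtain j0 where "j0 \<in> S" by blast
  then have M: "0 \<le> M"
    using v[of j0] norm_ge_zero order_trans by blast
  have S\<mu>: "(\<Sum>j\<in>S. v j) = N *\<^sub>R \<mu>"
    using N by (simp add: \<mu>_def)
  have u0: "(\<Sum>j\<in>S. u j) = 0"
    using S\<mu> by (simp add: u_def sum_subtractf N_def sum_constant_scaleR)
  have "(\<Sum>j\<in>S. (norm (u j))\<^sup>2) = (\<Sum>j\<in>S. (norm (v j))\<^sup>2) - 2 * ((\<Sum>j\<in>S. v j) \<bullet> \<mu>) + N * (\<mu> \<bullet> \<mu>)"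
  proof -
    have "(norm (u j))\<^sup>2 = (norm (v j))\<^sup>2 - 2 * (v j \<bullet> \<mu>) + \<mu> \<bullet> \<mu>" for j
      by (simp add: u_def power2_norm_eq_inner inner_diff_left inner_diff_right inner_commute)
    then show ?thesis
      by (simp add: sum.distrib sum_subtractf inner_sum_left sum_distrib_left N_def)
  qed
  also have "\<dots> = (\<Sum>j\<in>S. (norm (v j))\<^sup>2) - N * (\<mu> \<bullet> \<mu>)"
    by (simp add: S\<mu>)
  also have "\<dots> \<le> (\<Sum>j\<in>S. M\<^sup>2) - 0"
    using v N by (intro diff_mono sum_mono power_mono) auto
  finally have var: "(\<Sum>j\<in>S. (norm (u j))\<^sup>2) \<le> N * M\<^sup>2"
    by (simp add: N_def)
  have dev: "(norm ((1 / real K) *\<^sub>R (\<Sum>j\<in>Q. v j) - \<mu>))\<^sup>2 = (1 / real K)\<^sup>2 * (norm (\<Sum>j\<in>Q. u j))\<^sup>2"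
    if "Q \<in> ksets S K" for Q
  proof -
    have "(1 / real K) *\<^sub>R (\<Sum>j\<in>Q. v j) - \<mu> = (1 / real K) *\<^sub>R (\<Sum>j\<in>Q. u j)"
      using that K by (simp add: u_def sum_subtractf ksets_def sum_constant_scaleR scaleR_right_diff_distrib)
    then show ?thesis
      by (simp add: power_mult_distrib power_divide)
  qed
  have "avg (ksets S K) (\<lambda>Q. (norm ((1 / real K) *\<^sub>R (\<Sum>j\<in>Q. v j) - \<mu>))\<^sup>2)
      = (1 / real K)\<^sup>2 * (real K * (N - real K) / (N * (N - 1)) * (\<Sum>j\<in>S. (norm (u j))\<^sup>2))"
    using avg_ksets_norm_sum[OF S K u0] by (simp add: dev avg_mult_left N_def cong: avg_cong)
  also have "\<dots> \<le> (1 / real K)\<^sup>2 * (real K * (N - real K) / (N * (N - 1)) * (N * M\<^sup>2))"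
    using var N by (intro mult_left_mono) auto
  also have "\<dots> = M\<^sup>2 / real K * ((N - real K) / (N - 1))"
    using N K by (simp add: power2_eq_square divide_simps)
  finally have "sqrt (avg (ksets S K) (\<lambda>Q. (norm ((1 / real K) *\<^sub>R (\<Sum>j\<in>Q. v j) - \<mu>))\<^sup>2))
      \<le> sqrt (M\<^sup>2 / real K * ((N - real K) / (N - 1)))"
    by (rule real_sqrt_le_mono)
  also have "\<dots> = M / sqrt (real K) * sqrt ((N - real K) / (N - 1))"
    unfolding real_sqrt_mult using M by (simp add: real_sqrt_divide)
  finally show ?thesis
    unfolding \<mu>_def[symmetric]
    by (rule order_trans[OF avg_le_sqrt_avg_square[OF finite_ksets[OF S] ksets_nonempty[OF S less_imp_le[OF K(2)]]]])
qed

section \<open>Linear programming duality\<close>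

text \<open>Strong duality by separation. The pair (b, v) lies outside the cone of pairs of an
  attainable right-hand side and an upper bound on its cost. With \<open>v\<close> strictly below
  every feasible cost, no attainment of the primal optimum enters.\<close>

lemma dual_feasible_near_optimal:
  fixes a :: "'i \<Rightarrow> 'v::euclidean_space" and c :: "'i \<Rightarrow> real"
  assumes Q: "finite Q"
    and feas: "\<forall>j\<in>Q. 0 \<le> x0 j" "(\<Sum>j\<in>Q. x0 j *\<^sub>R a j) = b"
    and lower: "\<And>x. \<forall>j\<in>Q. 0 \<le> x j \<Longrightarrow> (\<Sum>j\<in>Q. x j *\<^sub>R a j) = b \<Longrightarrow> v < (\<Sum>j\<in>Q. c j * x j)"
  shows "\<exists>p. (\<forall>j\<in>Q. p \<bullet> a j \<le> c j) \<and> v < p \<bullet> b"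
proof -
  \<comment> \<open>The generator (0, 1) closes the cost coordinate upwards. Finite generation by
    \<open>G\<close> gives closedness, while the explicit cone \<open>C\<close> serves to exclude
    (b, v).\<close>
  define G where "G = insert (0, 1) ((\<lambda>j. (a j, c j)) ` Q)"
  define C where "C = {(\<Sum>j\<in>Q. x j *\<^sub>R a j, (\<Sum>j\<in>Q. c j * x j) + s) | x s. (\<forall>j\<in>Q. 0 \<le> x j) \<and> 0 \<le> s}"
  have "convex_cone C"
    unfolding convex_cone_iff
  proof (intro conjI ballI allI impI)
    show "0 \<in> C"
      unfolding C_def by (auto simp: zero_prod_def intro!: exI[of _ "\<lambda>_. 0"] exI[of _ 0])
  next
    fix y z assume "y \<in> C" "z \<in> C"
    then obtain x s x' s' where y: "y = (\<Sum>j\<in>Q. x j *\<^sub>R a j, (\<Sum>j\<in>Q. c j * x j) + s)" "\<forall>j\<in>Q. 0 \<le> x j" "0 \<le> s"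
      and z: "z = (\<Sum>j\<in>Q. x' j *\<^sub>R a j, (\<Sum>j\<in>Q. c j * x' j) + s')" "\<forall>j\<in>Q. 0 \<le> x' j" "0 \<le> s'"
      unfolding C_def by blast
    have "y + z = (\<Sum>j\<in>Q. (x j + x' j) *\<^sub>R a j, (\<Sum>j\<in>Q. c j * (x j + x' j)) + (s + s'))"
      by (simp add: y z scaleR_add_left sum.distrib distrib_left)
    then show "y + z \<in> C"
      unfolding C_def using y z by (auto intro!: exI[of _ "\<lambda>j. x j + x' j"] exI[of _ "s + s'"])
  next
    fix y and r :: real assume "y \<in> C" "0 \<le> r"
    then obtain x s where y: "y = (\<Sum>j\<in>Q. x j *\<^sub>R a j, (\<Sum>j\<in>Q. c j * x j) + s)" "\<forall>j\<in>Q. 0 \<le> x j" "0 \<le> s"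
      unfolding C_def by blast
    have "r *\<^sub>R y = (\<Sum>j\<in>Q. (r * x j) *\<^sub>R a j, (\<Sum>j\<in>Q. c j * (r * x j)) + r * s)"
      by (simp add: y scaleR_sum_right sum_distrib_left algebra_simps)
    then show "r *\<^sub>R y \<in> C"
      unfolding C_def using y \<open>0 \<le> r\<close> by (auto intro!: exI[of _ "\<lambda>j. r * x j"] exI[of _ "r * s"])
  qed
  moreover have "G \<subseteq> C"
  proof
    fix g assume "g \<in> G"
    then consider "g = (0, 1)" | j where "j \<in> Q" "g = (a j, c j)"
      unfolding G_def by blast
    then show "g \<in> C"
    proof cases
      case 1
      then show ?thesis
        unfolding C_def by (auto intro!: exI[of _ "\<lambda>_. 0"] exI[of _ 1])
    next
      case 2
      then have "(\<Sum>i\<in>Q. of_bool (i = j) *\<^sub>R a i) = a j" "(\<Sum>i\<in>Q. c i * of_bool (i = j)) = c j"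
        using Q by (simp_all add: of_bool_def if_distrib[of "\<lambda>t. t *\<^sub>R _"] if_distrib[of "\<lambda>t. _ * t"] cong: if_cong)
      then show ?thesis
        unfolding C_def using 2 by (intro CollectI exI[of _ "\<lambda>i. of_bool (i = j)"] exI[of _ 0]) auto
    qed
  qed
  ultimately have hull: "convex_cone hull G \<subseteq> C"
    by (metis hull_minimal)
  have "(b, v) \<notin> C"
    unfolding C_def using lower by (force simp: not_le)
  with hull have "(b, v) \<notin> convex_cone hull G"
    by blast
  moreover have "closed (convex_cone hull G)"
    using Q by (intro closed_convex_cone_hull) (simp add: G_def)
  ultimately obtain w \<beta> where w: "w \<bullet> (b, v) < \<beta>" "\<forall>y\<in>convex_cone hull G. \<beta> < w \<bullet> y"
    using separating_hyperplane_closed_point[OF convex_convex_cone_hull] by metis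
  \<comment> \<open>The separating functional, scaled so that its last component is \<open>-1\<close>, is the dual solution.\<close>
  obtain p t where wp: "w = (p, t)"
    by (cases w)
  have "\<beta> < 0"
    using w(2) convex_cone_hull_contains_0[of G] by auto
  then have neg: "p \<bullet> b + t * v < 0"
    using w(1) by (simp add: wp)
  \<comment> \<open>If the functional were negative at a generator, a nonnegative multiple of it
    would attain exactly the value \<beta>, contradicting strict separation.\<close>
  have gen: "0 \<le> w \<bullet> y" if "y \<in> G" for y
  proof (rule ccontr)
    assume "\<not> 0 \<le> w \<bullet> y"
    then have *: "w \<bullet> y < 0" by simp
    have "(\<beta> / (w \<bullet> y)) *\<^sub>R y \<in> convex_cone hull G"
      using * \<open>\<beta> < 0\<close> that by (intro convex_cone_hull_mul hull_inc divide_nonpos_neg) auto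
    with w(2) * show False by fastforce
  qed
  have t: "0 \<le> t"
    using gen[of "(0, 1)"] by (simp add: G_def wp)
  have pa: "0 \<le> p \<bullet> a j + t * c j" if "j \<in> Q" for j
    using gen[of "(a j, c j)"] that by (simp add: G_def wp)
  \<comment> \<open>With \<open>t = 0\<close>, \<open>p\<close> would be a Farkas certificate of
    infeasibility, which the feasible \<open>x0\<close> rules out.\<close>
  have "t \<noteq> 0"
  proof
    assume "t = 0"
    then have "0 \<le> (\<Sum>j\<in>Q. x0 j * (p \<bullet> a j))"
      using feas pa by (intro sum_nonneg) auto
    also have "\<dots> = p \<bullet> b"
      unfolding feas(2)[symmetric] by (simp add: inner_sum_right)
    finally show False
      using neg \<open>t = 0\<close> by simp
  qed
  with t have t: "0 < t" by simp
  show ?thesis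
  proof (intro exI conjI ballI)
    fix j assume "j \<in> Q"
    then show "(- (1 / t) *\<^sub>R p) \<bullet> a j \<le> c j"
      using pa[of j] t by (simp add: field_simps)
  next
    show "v < (- (1 / t) *\<^sub>R p) \<bullet> b"
      using neg t by (simp add: field_simps)
  qed
qed

text \<open>Rounding to a vertex: while the tight columns do not span, a direction orthogonal to
  them is free, and following it makes a further constraint tight. The induction is on the number of
  constraints that are not tight.\<close>

lemma dual_round_to_spanning:
  fixes a :: "'i \<Rightarrow> 'v::euclidean_space" and c :: "'i \<Rightarrow> real"
  assumes Q: "finite Q" and span: "span (a ` Q) = UNIV"
    and feas: "\<forall>j\<in>Q. 0 \<le> x j" "(\<Sum>j\<in>Q. x j *\<^sub>R a j) = b"
    and p: "\<forall>j\<in>Q. p \<bullet> a j \<le> c j"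
  shows "\<exists>q. (\<forall>j\<in>Q. q \<bullet> a j \<le> c j) \<and> p \<bullet> b \<le> q \<bullet> b \<and> span (a ` {j \<in> Q. q \<bullet> a j = c j}) = UNIV"
  using p
proof (induction "card Q - card {j \<in> Q. p \<bullet> a j = c j}" arbitrary: p rule: less_induct)
  case less
  define T where "T = {j \<in> Q. p \<bullet> a j = c j}"
  show ?case
  proof (cases "span (a ` T) = UNIV")
    case True
    then show ?thesis
      using less.prems unfolding T_def by blast
  next
    case False
    then have "dim (a ` T) < DIM('v)"
      by (metis dim_eq_full dim_subset_UNIV le_neq_implies_less)
    then obtain d0 where d0: "d0 \<noteq> 0" "\<And>y. y \<in> span (a ` T) \<Longrightarrow> orthogonal d0 y"
      by (rule orthogonal_to_subspace_exists) blast
    have orth0: "d0 \<bullet> a j = 0" if "j \<in> T" for j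
      using d0(2) that by (auto simp: orthogonal_def intro: span_base)
    \<comment> \<open>Since \<open>b\<close> is a nonnegative combination of the columns, an
      improving direction must run into some constraint: the dual is bounded because the primal is
      feasible.\<close>
    have up: "\<exists>j\<in>Q. 0 < d \<bullet> a j" if "0 < d \<bullet> b" for d
    proof (rule ccontr)
      assume "\<not> (\<exists>j\<in>Q. 0 < d \<bullet> a j)"
      then have "(\<Sum>j\<in>Q. x j * (d \<bullet> a j)) \<le> 0"
        using feas by (intro sum_nonpos mult_nonneg_nonpos) (auto simp: not_less)
      also have "(\<Sum>j\<in>Q. x j * (d \<bullet> a j)) = d \<bullet> b"
        unfolding feas(2)[symmetric] by (simp add: inner_sum_right)
      finally show False using that by simp
    qed
    have "\<exists>j\<in>Q. d0 \<bullet> a j \<noteq> 0"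
    proof (rule ccontr)
      assume *: "\<not> (\<exists>j\<in>Q. d0 \<bullet> a j \<noteq> 0)"
      have "orthogonal d0 d0"
      proof (rule orthogonal_to_span)
        show "d0 \<in> span (a ` Q)"
          by (simp only: span UNIV_I)
        show "orthogonal d0 y" if "y \<in> a ` Q" for y
          using that * by (auto simp: orthogonal_def)
      qed
      with d0 show False by (simp add: orthogonal_self)
    qed
    \<comment> \<open>The sign of \<open>d0\<close> is chosen so that the objective does not
      decrease. If \<open>d0\<close> leaves the objective unchanged, the sign is chosen so that some
      constraint blocks the move; such a constraint exists because the columns of \<open>Q\<close>
      span.\<close>
    then obtain d where d: "\<And>j. j \<in> T \<Longrightarrow> d \<bullet> a j = 0" "0 \<le> d \<bullet> b" "\<exists>j\<in>Q. 0 < d \<bullet> a j"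
    proof (cases "d0 \<bullet> b" "0::real" rule: linorder_cases)
      case less
      then show ?thesis using that[of "- d0"] up[of "- d0"] orth0 by simp
    next
      case greater
      then show ?thesis using that[of d0] up[of d0] orth0 by simp
    next
      case equal
      from \<open>\<exists>j\<in>Q. d0 \<bullet> a j \<noteq> 0\<close> obtain j where j: "j \<in> Q" "d0 \<bullet> a j \<noteq> 0" by blast
      then have "0 < (sgn (d0 \<bullet> a j) *\<^sub>R d0) \<bullet> a j"
        by (simp add: abs_sgn[symmetric] mult.commute[of "sgn _"])
      then show ?thesis
        using that[of "sgn (d0 \<bullet> a j) *\<^sub>R d0"] equal orth0 j(1) by auto
    qed
    \<comment> \<open>Moving from \<open>p\<close> along \<open>d\<close> keeps \<open>T\<close> tight and does not decrease the objective; the ratio test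
      stops at the first new tight constraint.\<close>
    define U where "U = {j \<in> Q. 0 < d \<bullet> a j}"
    define s where "s j = (c j - p \<bullet> a j) / (d \<bullet> a j)" for j
    have U: "finite U" "U \<noteq> {}"
      using Q d(3) by (auto simp: U_def)
    define t where "t = Min (s ` U)"
    have "t \<in> s ` U"
      unfolding t_def using U by (intro Min_in) auto
    then obtain j0 where j0: "j0 \<in> U" "t = s j0" by blast
    have t_le: "t \<le> s j" if "j \<in> U" for j
      unfolding t_def using U that by simp
    have t0: "0 \<le> t"
      using j0 less.prems by (auto simp: s_def U_def intro!: divide_nonneg_pos)
    define q where "q = p + t *\<^sub>R d"
    have q: "q \<bullet> y = p \<bullet> y + t * (d \<bullet> y)" for y
      by (simp add: q_def inner_add_left)
    have qfeas: "\<forall>j\<in>Q. q \<bullet> a j \<le> c j"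
    proof
      fix j assume j: "j \<in> Q"
      show "q \<bullet> a j \<le> c j"
      proof (cases "0 < d \<bullet> a j")
        case True
        then show ?thesis
          using t_le[of j] j by (simp add: q U_def s_def field_simps)
      next
        case False
        then have "t * (d \<bullet> a j) \<le> 0"
          using t0 by (simp add: mult_nonneg_nonpos)
        then show ?thesis
          using less.prems j by (force simp: q)
      qed
    qed
    have "insert j0 T \<subseteq> {j \<in> Q. q \<bullet> a j = c j}"
      using j0 d(1) by (auto simp: q T_def U_def s_def)
    moreover have "j0 \<notin> T"
      using j0 d(1) by (auto simp: U_def)
    ultimately have "card T < card {j \<in> Q. q \<bullet> a j = c j}"
      using Q by (intro psubset_card_mono) auto
    moreover have "card {j \<in> Q. q \<bullet> a j = c j} \<le> card Q"
      using Q by (intro card_mono) auto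
    ultimately have "card Q - card {j \<in> Q. q \<bullet> a j = c j} < card Q - card T"
      by linarith
    from less.hyps[OF this[unfolded T_def] qfeas] obtain r
      where "\<forall>j\<in>Q. r \<bullet> a j \<le> c j" "q \<bullet> b \<le> r \<bullet> b" "span (a ` {j \<in> Q. r \<bullet> a j = c j}) = UNIV"
      by blast
    moreover have "p \<bullet> b \<le> q \<bullet> b"
      using t0 d(2) by (simp add: q)
    ultimately show ?thesis
      by (meson order_trans)
  qed
qed

section \<open>Bases and basic dual solutions\<close>

lemma invertible_selection_of_spanning_columns:
  fixes A :: "real^'n^'m"
  assumes "span ((\<lambda>j. column j A) ` T) = UNIV"
  obtains e :: "'m \<Rightarrow> 'n" where "inj e" "range e \<subseteq> T" "invertible (sel_cols A e)"
proof -
  obtain B where B: "B \<subseteq> (\<lambda>j. column j A) ` T" "independent B" "span B = UNIV"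
    using maximal_independent_subset[of "(\<lambda>j. column j A) ` T"] assms
    by (metis span_mono span_span top.extremum_uniqueI)
  have finB: "finite B" and cardB: "card B = CARD('m)"
    using B independent_bound[of B] basis_card_eq_dim[of B UNIV] by (auto simp: dim_UNIV)
  obtain g :: "'m \<Rightarrow> real^'m" where g: "bij_betw g UNIV B"
    using finite_same_card_bij[of "UNIV :: 'm set" B] finB cardB by auto
  \<comment> \<open>Different indices may carry the same column, so one index is chosen for each
    basis vector. The selection is injective because the basis vectors are distinct.\<close>
  define e where "e k = (SOME j. j \<in> T \<and> column j A = g k)" for k
  have e: "e k \<in> T \<and> column (e k) A = g k" for k
  proof -
    have "g k \<in> (\<lambda>j. column j A) ` T"
      using g B(1) by (auto simp: bij_betw_def)
    then have "\<exists>j. j \<in> T \<and> column j A = g k" by auto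
    then show ?thesis
      unfolding e_def by (rule someI_ex)
  qed
  have "inj e"
    by (metis e g bij_betw_def injI inj_onD UNIV_I)
  have col: "column k (sel_cols A e) = g k" for k
    using e[of k] by (simp add: sel_cols_def column_def)
  then have "columns (sel_cols A e) = B"
    using g by (auto simp: columns_def bij_betw_def)
  then have "rank (sel_cols A e) = CARD('m)"
    using B by (simp add: column_rank_def dim_span[symmetric, of B] del: dim_span)
  then have "invertible (sel_cols A e)"
    by (simp add: invertible_det_nz det_eq_0_rank)
  with \<open>inj e\<close> e show ?thesis
    by (intro that[of e]) auto
qed

text \<open>Choose a basis among the tight columns. Tightness there reads p^T A_B = c_B^T, and
  multiplication by the inverse of A_B recovers \<open>p\<close>.\<close>

lemma basic_dual_solution_if_tight_spanning:
  fixes A :: "real^'n^'m"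
  assumes "span ((\<lambda>j. column j A) ` {j. p \<bullet> column j A = c $ j}) = UNIV"
  shows "basic_dual_solution A c p"
proof -
  obtain e :: "'m \<Rightarrow> 'n" where e: "inj e" "range e \<subseteq> {j. p \<bullet> column j A = c $ j}" "invertible (sel_cols A e)"
    using assms by (rule invertible_selection_of_spanning_columns)
  have "p v* sel_cols A e = sel c e"
    using e(2) by (auto simp: vec_eq_iff vector_matrix_mult_def sel_cols_def sel_def inner_vec_def column_def
        mult.commute image_subset_iff)
  moreover have "sel_cols A e ** matrix_inv (sel_cols A e) = mat 1"
    using e(3) unfolding invertible_def matrix_inv_def by (rule someI2_ex) blast
  ultimately have "p = sel c e v* matrix_inv (sel_cols A e)"
    by (metis vector_matrix_mul_assoc vector_matrix_mul_rid)
  moreover have "card (range e) = CARD('m)"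
    using e(1) by (rule card_image)
  ultimately show ?thesis
    unfolding basic_dual_solution_def using e by (auto simp: bij_betw_def)
qed

text \<open>Guarantees that the bound \<gamma> is tested on at least one vector, which makes it
  nonnegative.\<close>

lemma exists_basic_dual_solution:
  fixes A :: "real^'n^'m"
  assumes "rank A = CARD('m)"
  obtains p where "basic_dual_solution A c p"
proof -
  have "span ((\<lambda>j. column j A) ` UNIV) = UNIV"
    using assms dim_eq_full[of "(\<lambda>j. column j A) ` UNIV"] by (simp add: rank_sub_def flip: rank_sub_UNIV)
  then obtain e :: "'m \<Rightarrow> 'n" where e: "inj e" "invertible (sel_cols A e)"
    by (rule invertible_selection_of_spanning_columns)
  moreover have "card (range e) = CARD('m)"
    using e(1) by (rule card_image)
  ultimately show ?thesis
    by (intro that) (auto simp: basic_dual_solution_def bij_betw_def)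
qed

lemma norm_le_sqrt_card:
  fixes y :: "real^'m"
  assumes "\<And>i. \<bar>y $ i\<bar> \<le> M"
  shows "norm y \<le> sqrt (real CARD('m)) * M"
proof -
  have "0 \<le> M"
    using assms order_trans abs_ge_zero by blast
  have "norm y \<le> L2_set (\<lambda>_. M) (UNIV :: 'm set)"
    unfolding norm_vec_def by (intro L2_set_mono) (use assms in auto)
  then show ?thesis
    using \<open>0 \<le> M\<close> by (simp add: L2_set_constant)
qed

lemma abs_le_max_norm: "\<bar>A $ i $ j\<bar> \<le> max_norm A" for A :: "real^'n^'m"
proof -
  have "finite {\<bar>A $ i $ j\<bar> | i j. True}"
    using finite_imageI[of UNIV "\<lambda>(i, j). \<bar>A $ i $ j\<bar>"]
    by (rule finite_subset[rotated]) auto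
  then show ?thesis
    unfolding max_norm_def by (rule Max_ge) auto
qed

text \<open>Bounds the sampled optimum using a nonnegative \<open>y\<close> that may violate its
  constraints. The penalty rate is the Euclidean norm of a basic dual solution, at most sqrt m times
  its maximum norm.\<close>

lemma opt_val_sub_le:
  fixes A :: "real^'n^'m"
  assumes feas: "feas_sub A b Q \<noteq> {}" and rank: "rank_sub A Q = CARD('m)"
    and \<gamma>: "\<And>p. basic_dual_solution A c p \<Longrightarrow> infnorm p \<le> \<gamma>"
    and y: "\<And>j. j \<in> Q \<Longrightarrow> 0 \<le> y j"
  shows "opt_val (cost_sub c Q) (feas_sub A b Q)
    \<le> ereal ((\<Sum>j\<in>Q. c $ j * y j) + \<gamma> * sqrt (real CARD('m)) * norm ((\<Sum>j\<in>Q. y j *\<^sub>R column j A) - b))"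
    (is "?V \<le> ereal ?R")
proof (rule ccontr)
  assume "\<not> ?V \<le> ereal ?R"
  then have "ereal ?R < ?V"
    by (simp only: not_le)
  \<comment> \<open>The strict inequality leaves room for a real \<open>v\<close>, so a merely
    near-optimal dual point suffices for the contradiction.\<close>
  from ereal_dense2[OF this] obtain v where v: "?R < v" "ereal v < ?V"
    by (auto simp only: less_ereal.simps(1))
  have eqs: "(\<Sum>j\<in>Q. A $ i $ j * x j) = (\<Sum>j\<in>Q. x j *\<^sub>R column j A) $ i" for x i
    by (simp add: column_def mult.commute)
  obtain x0 where "x0 \<in> feas_sub A b Q"
    using feas by blast
  then have x0: "\<forall>j\<in>Q. 0 \<le> x0 j" "(\<Sum>j\<in>Q. x0 j *\<^sub>R column j A) = b"
    unfolding feas_sub_def by (auto simp: eqs vec_eq_iff simp del: sum_component)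
  have "v < (\<Sum>j\<in>Q. c $ j * x j)"
    if x: "\<forall>j\<in>Q. 0 \<le> x j" "(\<Sum>j\<in>Q. x j *\<^sub>R column j A) = b" for x
  proof -
    have "restrict x Q \<in> feas_sub A b Q"
      unfolding feas_sub_def mem_Collect_eq eqs using x by auto
    then have "?V \<le> ereal (cost_sub c Q (restrict x Q))"
      unfolding opt_val_def by (rule INF_lower)
    also have "cost_sub c Q (restrict x Q) = (\<Sum>j\<in>Q. c $ j * x j)"
      by (simp add: cost_sub_def)
    finally have "ereal v < ereal (\<Sum>j\<in>Q. c $ j * x j)"
      by (rule less_le_trans[OF v(2)])
    then show ?thesis by simp
  qed
  with x0 have "\<exists>p. (\<forall>j\<in>Q. p \<bullet> column j A \<le> c $ j) \<and> v < p \<bullet> b"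
    by (intro dual_feasible_near_optimal finite)
  then obtain p where p: "\<forall>j\<in>Q. p \<bullet> column j A \<le> c $ j" "v < p \<bullet> b"
    by blast
  have "span ((\<lambda>j. column j A) ` Q) = UNIV"
    using rank dim_eq_full[of "(\<lambda>j. column j A) ` Q"] by (simp add: rank_sub_def)
  from dual_round_to_spanning[OF finite this x0 p(1)] obtain q
    where q: "\<forall>j\<in>Q. q \<bullet> column j A \<le> c $ j" "p \<bullet> b \<le> q \<bullet> b"
      and tight: "span ((\<lambda>j. column j A) ` {j \<in> Q. q \<bullet> column j A = c $ j}) = UNIV"
    by blast
  \<comment> \<open>\<open>q\<close> satisfies the dual constraints only on \<open>Q\<close>, but a
    basic solution of the complete dual may be infeasible, so \<gamma> still bounds it.\<close>
  have "span ((\<lambda>j. column j A) ` {j. q \<bullet> column j A = c $ j}) = UNIV"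
    using tight span_mono[of "(\<lambda>j. column j A) ` {j \<in> Q. q \<bullet> column j A = c $ j}"
        "(\<lambda>j. column j A) ` {j. q \<bullet> column j A = c $ j}"] by auto
  then have "basic_dual_solution A c q"
    by (rule basic_dual_solution_if_tight_spanning)
  from \<gamma>[OF this] have "norm q \<le> sqrt (real CARD('m)) * \<gamma>"
    by (intro norm_le_sqrt_card order_trans[OF component_le_infnorm_cart])
  then have nq: "norm q * norm ((\<Sum>j\<in>Q. y j *\<^sub>R column j A) - b)
      \<le> \<gamma> * sqrt (real CARD('m)) * norm ((\<Sum>j\<in>Q. y j *\<^sub>R column j A) - b)"
    by (intro mult_right_mono) (auto simp: mult.commute)
  \<comment> \<open>\<open>y\<close> violates the constraints of the sampled problem; the violation is priced by \<open>q\<close>.\<close>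
  have "q \<bullet> b = q \<bullet> (\<Sum>j\<in>Q. y j *\<^sub>R column j A) - q \<bullet> ((\<Sum>j\<in>Q. y j *\<^sub>R column j A) - b)"
    by (simp add: inner_diff_right)
  also have "\<dots> \<le> q \<bullet> (\<Sum>j\<in>Q. y j *\<^sub>R column j A) + norm q * norm ((\<Sum>j\<in>Q. y j *\<^sub>R column j A) - b)"
    using Cauchy_Schwarz_ineq2[of q "(\<Sum>j\<in>Q. y j *\<^sub>R column j A) - b"] by linarith
  also have "q \<bullet> (\<Sum>j\<in>Q. y j *\<^sub>R column j A) = (\<Sum>j\<in>Q. y j * (q \<bullet> column j A))"
    by (simp add: inner_sum_right)
  also have "\<dots> \<le> (\<Sum>j\<in>Q. y j * c $ j)"
    using q(1) y by (intro sum_mono mult_left_mono) auto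
  finally have "q \<bullet> b \<le> ?R"
    using nq by (simp add: mult.commute)
  with p q v show False by linarith
qed

section \<open>The column randomization bound\<close>

text \<open>The upper bounds on the coordinates give compactness, and with it a minimiser of the
  distributed problem.\<close>

lemma compact_feas_distr: "compact (feas_distr A b C)" for A :: "real^'n^'m"
proof -
  have eq: "feas_distr A b C = (\<lambda>x. A *v x) -` {b} \<inter> cbox 0 (\<chi> j. C / real CARD('n))"
    by (auto simp: feas_distr_def mem_box_cart)
  have "closed ((\<lambda>x. A *v x) -` {b})"
    by (intro continuous_closed_vimage matrix_vector_mult_linear_continuous_at closed_singleton)
  then show ?thesis
    unfolding eq by (intro closed_Int_compact compact_cbox)
qed

theorem mainTheorem13:
  fixes A :: "real^'n^'m" and b :: "real^'m" and c :: "real^'n"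
    and C \<gamma> \<delta> :: real and K :: nat
  assumes feasible: "feas A b \<noteq> {}"
    and bounded: "bdd_below ((\<lambda>x. c \<bullet> x) ` feas A b)"
    and full_rank: "rank A = CARD('m)"
    and c_norm: "norm c = 1"
    and C_nonneg: "0 \<le> C"
    and K_bounds: "1 \<le> K" "K < CARD('n)"
    and gamma_bound: "\<And>p. basic_dual_solution A c p \<Longrightarrow> infnorm p \<le> \<gamma>"
    and delta_bounds: "0 < \<delta>" "\<delta> < 1"
  shows "measure_pmf.prob (sample_wo_rep K)
      {Q :: 'n set. feas_sub A b Q \<noteq> {} \<and> rank_sub A Q = CARD('m) \<longrightarrow>
        gap A b c (opt_val (cost_sub c Q) (feas_sub A b Q))
        \<le> gap A b c (opt_val (\<lambda>x. c \<bullet> x) (feas_distr A b C))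
          + ereal (C / sqrt (real K) * (1 + \<gamma> * real CARD('m) * max_norm A) *
              (sqrt ((real CARD('n) - real K) / (real CARD('n) - 1))
               + sqrt (2 / H_factor CARD('n) K * ln (2 / \<delta>))))}
    \<ge> 1 - \<delta>"
proof -
  define s where "s = sqrt ((real CARD('n) - real K) / (real CARD('n) - 1))"
  define t where "t = sqrt (2 / H_factor CARD('n) K * ln (2 / \<delta>))"
  define W where "W = 1 + \<gamma> * real CARD('m) * max_norm A"
  define D where "D = C / sqrt (real K) * W"
  define G where "G = {Q :: 'n set. feas_sub A b Q \<noteq> {} \<and> rank_sub A Q = CARD('m) \<longrightarrow>
        gap A b c (opt_val (cost_sub c Q) (feas_sub A b Q))
        \<le> gap A b c (opt_val (\<lambda>x. c \<bullet> x) (feas_distr A b C)) + ereal (D * (s + t))}"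
  have K: "K \<le> CARD('n)"
    using K_bounds by simp
  \<comment> \<open>A finite optimal value lets the two gaps be compared by ordinary subtraction of
    a real number.\<close>
  have "\<exists>v0. opt_val (\<lambda>x. c \<bullet> x) (feas A b) = ereal v0"
  proof -
    obtain x0 where "x0 \<in> feas A b"
      using feasible by blast
    then have "opt_val (\<lambda>x. c \<bullet> x) (feas A b) \<le> ereal (c \<bullet> x0)"
      unfolding opt_val_def by (rule INF_lower)
    moreover obtain l where "\<And>x. x \<in> feas A b \<Longrightarrow> l \<le> c \<bullet> x"
      using bounded by (auto simp: bdd_below_def)
    then have "ereal l \<le> opt_val (\<lambda>x. c \<bullet> x) (feas A b)"
      unfolding opt_val_def by (intro INF_greatest) simp
    ultimately show ?thesis
      by (cases "opt_val (\<lambda>x. c \<bullet> x) (feas A b)") auto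
  qed
  then obtain v0 where v0: "opt_val (\<lambda>x. c \<bullet> x) (feas A b) = ereal v0" ..
  have "1 - \<delta> \<le> measure_pmf.prob (sample_wo_rep K) G"
  proof (cases "feas_distr A b C = {}")
    case True
    \<comment> \<open>The optimal value over the empty set is infinite, so the right-hand side is
      infinite for every sample.\<close>
    then have "G = UNIV"
      by (simp add: G_def gap_def opt_val_def v0 top_ereal_def)
    then show ?thesis
      using delta_bounds by simp
  next
    case False
    have "continuous_on (feas_distr A b C) (\<lambda>x. c \<bullet> x)"
      by (intro continuous_intros)
    from continuous_attains_inf[OF compact_feas_distr False this] obtain x
      where x: "x \<in> feas_distr A b C" "\<And>x'. x' \<in> feas_distr A b C \<Longrightarrow> c \<bullet> x \<le> c \<bullet> x'"
      by blast
    define n where "n = real CARD('n)"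
    \<comment> \<open>The factor n makes the population means equal to the cost of \<open>x\<close>
      and to \<open>b\<close>, and the bound C/n on the coordinates becomes the bound C on the
      weights.\<close>
    define f1 where "f1 Q = norm ((1 / real K) *\<^sub>R (\<Sum>j\<in>Q. n * x $ j * c $ j) - (1 / n) *\<^sub>R (\<Sum>j\<in>UNIV. n * x $ j * c $ j))" for Q
    define f2 where "f2 Q = norm ((1 / real K) *\<^sub>R (\<Sum>j\<in>Q. (n * x $ j) *\<^sub>R column j A)
        - (1 / n) *\<^sub>R (\<Sum>j\<in>UNIV. (n * x $ j) *\<^sub>R column j A))" for Q
    define \<gamma>' where "\<gamma>' = \<gamma> * sqrt (real CARD('m))"
    define f where "f Q = f1 Q + \<gamma>' * f2 Q" for Q
    have n: "0 < n"
      by (simp add: n_def)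
    have x_bounds: "0 \<le> x $ j" "n * x $ j \<le> C" for j
      using x(1) n by (auto simp: feas_distr_def n_def field_simps)
    have Ax: "(\<Sum>j\<in>UNIV. x $ j *\<^sub>R column j A) = b"
      using x(1) by (simp add: feas_distr_def matrix_mult_sum scalar_mult_eq_scaleR)
    have \<gamma>: "0 \<le> \<gamma>"
      using exists_basic_dual_solution[OF full_rank, of c] gamma_bound infnorm_pos_le order_trans by metis
    then have \<gamma>': "0 \<le> \<gamma>'"
      by (simp add: \<gamma>'_def)
    have "0 \<le> max_norm A"
      using abs_le_max_norm[of A] order_trans abs_ge_zero by blast
    with \<gamma> have W: "0 < W"
      by (auto simp: W_def intro!: add_pos_nonneg)
    have vopt: "opt_val (\<lambda>x. c \<bullet> x) (feas_distr A b C) = ereal (c \<bullet> x)"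
      unfolding opt_val_def using x by (intro antisym INF_lower INF_greatest) auto
    have good: "Q \<in> G" if "f Q \<le> D * (s + t)" for Q
      unfolding G_def mem_Collect_eq
    proof (intro impI, elim conjE)
      assume Q: "feas_sub A b Q \<noteq> {}" "rank_sub A Q = CARD('m)"
      let ?y = "\<lambda>j. n * x $ j / real K"
      have "opt_val (cost_sub c Q) (feas_sub A b Q)
        \<le> ereal ((\<Sum>j\<in>Q. c $ j * ?y j) + \<gamma>' * norm ((\<Sum>j\<in>Q. ?y j *\<^sub>R column j A) - b))"
        unfolding \<gamma>'_def using x_bounds n by (intro opt_val_sub_le Q gamma_bound) auto
      also have "norm ((\<Sum>j\<in>Q. ?y j *\<^sub>R column j A) - b) = f2 Q"
        using n by (simp add: f2_def scaleR_sum_right Ax)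
      also have "(\<Sum>j\<in>Q. c $ j * ?y j) \<le> c \<bullet> x + f1 Q"
      proof -
        have "(1 / real K) *\<^sub>R (\<Sum>j\<in>Q. n * x $ j * c $ j) = (\<Sum>j\<in>Q. c $ j * ?y j)"
          by (simp add: sum_divide_distrib mult_ac)
        moreover have "(1 / n) *\<^sub>R (\<Sum>j\<in>UNIV. n * x $ j * c $ j) = c \<bullet> x"
          using n by (simp add: inner_vec_def sum_divide_distrib mult_ac)
        ultimately show ?thesis
          by (simp add: f1_def)
      qed
      finally have "opt_val (cost_sub c Q) (feas_sub A b Q) \<le> ereal (c \<bullet> x + f Q)"
        by (simp add: f_def add.assoc)
      also have "\<dots> \<le> ereal (c \<bullet> x + D * (s + t))"
        using that by simp
      finally show "gap A b c (opt_val (cost_sub c Q) (feas_sub A b Q))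
        \<le> gap A b c (opt_val (\<lambda>x. c \<bullet> x) (feas_distr A b C)) + ereal (D * (s + t))"
        unfolding gap_def v0 vopt
        by (cases "opt_val (cost_sub c Q) (feas_sub A b Q)") auto
    qed
    show ?thesis
    proof (cases "C = 0")
      \<comment> \<open>The tail bound requires a positive \<beta>, so C = 0 is treated apart: then
        \<open>x = 0\<close> and both deviations vanish.\<close>
      case True
      then have "x = 0"
        using x(1) by (auto simp: feas_distr_def vec_eq_iff intro: antisym)
      then have "G = UNIV"
        using good True by (auto simp: f_def f1_def f2_def D_def)
      then show ?thesis
        using delta_bounds by simp
    next
      case False
      with C_nonneg have C: "0 < C" by simp
      define M where "M = C * (sqrt (real CARD('m)) * max_norm A)"
      have b1: "norm (n * x $ j * c $ j) \<le> C" for j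
      proof -
        have "norm (n * x $ j * c $ j) \<le> C * 1"
          unfolding norm_mult[of "n * x $ j"] using component_le_norm_cart[of c j] x_bounds n C
          by (intro mult_mono) (auto simp: c_norm)
        then show ?thesis by simp
      qed
      have b2: "norm ((n * x $ j) *\<^sub>R column j A) \<le> M" for j
        unfolding norm_scaleR M_def using x_bounds n C
        by (intro mult_mono norm_le_sqrt_card) (auto simp: column_def abs_le_max_norm)
      \<comment> \<open>One factor sqrt m comes from the norm of the dual vector and one from the
        norm of a column; together they give the m in \<open>W\<close>.\<close>
      have CW: "C + \<gamma>' * M = C * W"
        by (simp add: M_def \<gamma>'_def W_def algebra_simps)
      define \<beta> where "\<beta> = 2 * (C * W) / real K"
      have "swap_bounded UNIV K f (2 * C / real K + \<gamma>' * (2 * M / real K))"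
        unfolding f_def[abs_def] f1_def f2_def
        by (intro swap_bounded_add swap_bounded_mult swap_bounded_norm_mean b1 b2 \<gamma>') auto
      also have "2 * C / real K + \<gamma>' * (2 * M / real K) = \<beta>"
        unfolding \<beta>_def CW[symmetric] by (simp add: algebra_simps add_divide_distrib)
      finally have swap: "swap_bounded UNIV K f \<beta>" .
      have "avg (ksets UNIV K) f1 \<le> C / sqrt (real K) * s"
        unfolding f1_def[abs_def] n_def s_def
        using K_bounds b1 unfolding n_def by (intro avg_ksets_norm_sum_le) auto
      moreover have "avg (ksets UNIV K) f2 \<le> M / sqrt (real K) * s"
        unfolding f2_def[abs_def] n_def s_def
        using K_bounds b2 unfolding n_def by (intro avg_ksets_norm_sum_le) auto
      then have "\<gamma>' * avg (ksets UNIV K) f2 \<le> \<gamma>' * (M / sqrt (real K) * s)"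
        using \<gamma>' by (rule mult_left_mono)
      ultimately have "avg (ksets UNIV K) f \<le> C / sqrt (real K) * s + \<gamma>' * (M / sqrt (real K) * s)"
        unfolding f_def[abs_def] avg_add avg_mult_left by (rule add_mono)
      also have "\<dots> = (C + \<gamma>' * M) / sqrt (real K) * s"
        by (simp add: algebra_simps add_divide_distrib)
      also have "\<dots> = D * s"
        unfolding CW D_def by simp
      finally have mean: "avg (ksets UNIV K) f \<le> D * s" .
      have H: "0 < H_factor CARD('n) K"
        using K_bounds by (rule H_factor_pos)
      have L: "0 < ln (2 / \<delta>)"
        using delta_bounds by simp
      have D: "0 < D"
        using C W K_bounds by (simp add: D_def)
      have \<beta>: "0 < \<beta>"
        using C W K_bounds by (simp add: \<beta>_def)
      have t: "0 < t" "t\<^sup>2 = 2 / H_factor CARD('n) K * ln (2 / \<delta>)"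
        using H L by (simp_all add: t_def)
      \<comment> \<open>With this identity, \<open>t\<close> is exactly the deviation, in units of
        \<open>D\<close>, at which the tail exponent equals - ln (2 / \<delta>).\<close>
      have "\<beta>\<^sup>2 * real K = 4 * D\<^sup>2"
        using K_bounds by (simp add: \<beta>_def D_def power_mult_distrib power_divide) (simp add: power2_eq_square)
      moreover have "2 * (D * t)\<^sup>2 * H_factor CARD('n) K = 4 * D\<^sup>2 * ln (2 / \<delta>)"
        using H by (simp add: power_mult_distrib t(2))
      ultimately have expo: "- 2 * (D * t)\<^sup>2 * H_factor CARD('n) K / (\<beta>\<^sup>2 * real K) = - ln (2 / \<delta>)"
        using D by simp
      have "avg (ksets UNIV K) (\<lambda>Q. of_bool (f Q \<ge> avg (ksets UNIV K) f + D * t))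
          \<le> exp (- 2 * (D * t)\<^sup>2 * H_factor CARD('n) K / (\<beta>\<^sup>2 * real K))"
        by (rule concentration_ksets) (use K_bounds swap \<beta> D t in auto)
      also have "\<dots> = \<delta> / 2"
        unfolding expo using delta_bounds by (simp add: exp_minus)
      finally have "1 - \<delta> \<le> 1 - avg (ksets UNIV K) (\<lambda>Q. of_bool (f Q \<ge> avg (ksets UNIV K) f + D * t))"
        using delta_bounds by simp
      also have "\<dots> \<le> measure_pmf.prob (sample_wo_rep K) G"
      proof (rule prob_sample_ge[OF K])
        fix Q assume "Q \<notin> G"
        \<comment> \<open>A bad sample exceeds \<open>D * s + D * t\<close>, and since the mean of
          \<open>f\<close> is at most \<open>D * s\<close>, it exceeds the mean by at least
          \<open>D * t\<close>.\<close>
        then have "D * (s + t) < f Q"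
          using good by force
        then show "f Q \<ge> avg (ksets UNIV K) f + D * t"
          using mean by (simp add: distrib_left)
      qed
      finally show ?thesis .
    qed
  qed
  then show ?thesis
    unfolding G_def D_def W_def s_def t_def .
qed

end
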